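(* Consider a matrix pair $(A,C)$ with $A\in\mathbb{R}^{n\times n}$, $C\in\mathbb{R}^{q\times n}$, the pair $(A_{\mathrm{ob}},C_{\mathrm{ob}})$ describing its observable subsystem (of order $n-p$), and a sampling scheme $\{t_i\}_{i=1}^k$ such that $$\operatorname{rank}\big(O_{\mathrm s}(A_{\mathrm{ob}},C_{\mathrm{ob}})\big)=n-p .$$ Then for such a sampling scheme it holds that $O_{\mathrm s}(A,C)h\neq 0$ for all $h\in\mathbb{R}^n$ with $h\notin \operatorname{null}(O(A,C))$. (The statement holds both in the continuous-time and in the discrete-time setting, with the corresponding sample-based observability matrix $O_{\mathrm s}$.)
   Context: System: $x^+=Ax(t)+Bu(t)$, $y(t)=Cx(t)+Du(t)$ with $A\in\mathbb{R}^{n\times n}$, $B\in\mathbb{R}^{n\times m}$, $C\in\mathbb{R}^{q\times n}$, $D\in\mathbb{R}^{q\times m}$, where $x^+$ denotes $\dot x(t)$ for continuous-time systems and $x(t+1)$ for discrete-time systems. Observability matrix: for $M\in\mathbb{R}^{n\times n}$ and $N$ with $n$ columns, $O(M,N)$ is the matrix obtained by stacking $N, NM, NM^2,\dots,NM^{n-1}$ vertically. Sampling scheme: a finite set of arbitrary time instances $\{t_i\}_{i=1}^k$, $k\ge 1$, with $0\le t_1$ and $t_i<t_{i+1}$ for $i=1,\dots,k-1$ (real numbers in continuous time, integers in discrete time). Sample-based observability matrix: for a pair $(M,N)$ and the sampling scheme, $O_{\mathrm s}(M,N)$ is the matrix obtained by stacking vertically $Ne^{Mt_1},\dots,Ne^{Mt_k}$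 in the continuous-time case, and $NM^{t_1},\dots,NM^{t_k}$ in the discrete-time case. Observable subsystem: let $p$ be the dimension of the unobservable subspace $\operatorname{null}(O(A,C))$. There is an invertible $P_{\mathrm o}\in\mathbb{R}^{n\times n}$ with $$P_{\mathrm o}^{-1}AP_{\mathrm o}=\begin{pmatrix}A_{\mathrm{ob}}&0\\ A_{21}&A_{\overline{\mathrm{ob}}}\end{pmatrix},\qquad CP_{\mathrm o}=\begin{pmatrix}C_{\mathrm{ob}}&0\end{pmatrix},$$ where $A_{\mathrm{ob}}\in\mathbb{R}^{(n-p)\times(n-p)}$, $C_{\mathrm{ob}}\in\mathbb{R}^{q\times(n-p)}$ and $(A_{\mathrm{ob}},C_{\mathrm{ob}})$ is observable; $(A_{\mathrm{ob}},C_{\mathrm{ob}})$ is called the observable subsystem. The same sampling scheme is used in $O_{\mathrm s}(A,C)$ and $O_{\mathrm s}(A_{\mathrm{ob}},C_{\mathrm{ob}})$. *)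

theory Defs
  imports Complex_Main "Jordan_Normal_Form.Matrix_Kernel" "Jordan_Normal_Form.DL_Rank"
begin

(* Vertical stacking; the column count is explicit because the list may be empty. *)
definition stack_rows :: "nat \<Rightarrow> real mat list \<Rightarrow> real mat" where
  "stack_rows nc Ms = mat_of_rows nc (concat (map rows Ms))"

definition obs_mat :: "real mat \<Rightarrow> real mat \<Rightarrow> real mat" where
  "obs_mat M N = stack_rows (dim_row M) (map (\<lambda>i. N * (M ^\<^sub>m i)) [0..<dim_row M])"

definition observable :: "real mat \<Rightarrow> real mat \<Rightarrow> bool" where
  "observable M N \<longleftrightarrow> vec_space.rank (dim_row (obs_mat M N)) (obs_mat M N) = dim_row M"

(* The exponential series, summed entrywise; it always converges, see summable_mat_exp below. *)
definition mat_exp :: "real mat \<Rightarrow> real mat" where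
  "mat_exp M = mat (dim_row M) (dim_row M) (\<lambda>(i, j). \<Sum>k. (M ^\<^sub>m k) $$ (i, j) / fact k)"

(* The instants t_1 < ... < t_k as a list, over the reals in continuous time and over the
   natural numbers (that is, the nonnegative integers) in discrete time. *)
definition sampling_scheme :: "'a :: {zero, linorder} list \<Rightarrow> bool" where
  "sampling_scheme ts \<longleftrightarrow> ts \<noteq> [] \<and> 0 \<le> hd ts \<and> sorted_wrt (<) ts"

definition sample_obs_mat_ct :: "real mat \<Rightarrow> real mat \<Rightarrow> real list \<Rightarrow> real mat" where
  "sample_obs_mat_ct M N ts = stack_rows (dim_row M) (map (\<lambda>t. N * mat_exp (t \<cdot>\<^sub>m M)) ts)"

definition sample_obs_mat_dt :: "real mat \<Rightarrow> real mat \<Rightarrow> nat list \<Rightarrow> real mat" where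
  "sample_obs_mat_dt M N ts = stack_rows (dim_row M) (map (\<lambda>t. N * (M ^\<^sub>m t)) ts)"

(* P is the transformation P_o and Q its inverse.  The second four_block_mat, whose lower
   blocks have no rows, is the block row (C_ob 0). *)
definition observable_subsystem :: "real mat \<Rightarrow> real mat \<Rightarrow> real mat \<Rightarrow> real mat \<Rightarrow> bool" where
  "observable_subsystem A C A_ob C_ob \<longleftrightarrow>
    (let n = dim_row A; q = dim_row C; p = kernel_dim (obs_mat A C) in
      A_ob \<in> carrier_mat (n - p) (n - p) \<and> C_ob \<in> carrier_mat q (n - p) \<and>
      observable A_ob C_ob \<and>
      (\<exists>P Q A21 A_unob.
        P \<in> carrier_mat n n \<and> Q \<in> carrier_mat n n \<and> inverts_mat P Q \<and> inverts_mat Q P \<and>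
        A21 \<in> carrier_mat p (n - p) \<and> A_unob \<in> carrier_mat p p \<and>
        Q * A * P = four_block_mat A_ob (0\<^sub>m (n - p) p) A21 A_unob \<and>
        C * P = four_block_mat C_ob (0\<^sub>m q p) (0\<^sub>m 0 (n - p)) (0\<^sub>m 0 p)))"

lemma stack_rows_map_carrier:
  assumes "\<And>x. x \<in> set xs \<Longrightarrow> dim_row (f x) = q"
  shows "stack_rows nc (map f xs) \<in> carrier_mat (length xs * q) nc"
proof -
  have "length (concat (map rows (map f xs))) = length xs * q"
    using assms by (induction xs) auto
  then show ?thesis
    unfolding stack_rows_def by (metis mat_of_rows_carrier(1))
qed

lemma obs_mat_carrier:
  "obs_mat M N \<in> carrier_mat (dim_row M * dim_row N) (dim_row M)"
proof -
  have "stack_rows (dim_row M) (map (\<lambda>i. N * (M ^\<^sub>m i)) [0..<dim_row M])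
    \<in> carrier_mat (length [0..<dim_row M] * dim_row N) (dim_row M)"
    by (rule stack_rows_map_carrier) (rule index_mult_mat)
  then show ?thesis unfolding obs_mat_def by (simp only: length_upt diff_zero)
qed

lemma sample_obs_mat_ct_carrier:
  "sample_obs_mat_ct M N ts \<in> carrier_mat (length ts * dim_row N) (dim_row M)"
  unfolding sample_obs_mat_ct_def by (rule stack_rows_map_carrier) (rule index_mult_mat)

lemma sample_obs_mat_dt_carrier:
  "sample_obs_mat_dt M N ts \<in> carrier_mat (length ts * dim_row N) (dim_row M)"
  unfolding sample_obs_mat_dt_def by (rule stack_rows_map_carrier) (rule index_mult_mat)

lemma pow_mat_entry_bound:
  fixes M :: "real mat"
  assumes M: "M \<in> carrier_mat n n"
    and c: "\<And>i j. i < n \<Longrightarrow> j < n \<Longrightarrow> \<bar>M $$ (i, j)\<bar> \<le> c"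
    and "i < n" "j < n"
  shows "\<bar>(M ^\<^sub>m k) $$ (i, j)\<bar> \<le> (real n * c) ^ k"
  using assms(3,4)
proof (induction k arbitrary: i j)
  case 0
  then show ?case using M by (auto simp: one_mat_def)
next
  case (Suc k)
  have c0: "0 \<le> c" using c[OF Suc.prems] by linarith
  have Mk: "M ^\<^sub>m k \<in> carrier_mat n n" using M by (rule pow_carrier_mat)
  have "(M ^\<^sub>m Suc k) $$ (i, j) = (\<Sum>l<n. (M ^\<^sub>m k) $$ (i, l) * M $$ (l, j))"
    using M Mk Suc.prems by (auto simp: scalar_prod_def lessThan_atLeast0)
  also have "\<bar>\<dots>\<bar> \<le> (\<Sum>l<n. \<bar>(M ^\<^sub>m k) $$ (i, l) * M $$ (l, j)\<bar>)"
    by (rule sum_abs)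
  also have "\<dots> \<le> (\<Sum>l<n. (real n * c) ^ k * c)"
    using Suc c c0 by (intro sum_mono) (auto simp: abs_mult intro!: mult_mono)
  also have "\<dots> = (real n * c) ^ Suc k" by (simp add: algebra_simps)
  finally show ?case .
qed

lemma summable_mat_exp:
  fixes M :: "real mat"
  assumes M: "M \<in> carrier_mat n n" and ij: "i < n" "j < n"
  shows "summable (\<lambda>k. (M ^\<^sub>m k) $$ (i, j) / fact k)"
proof -
  define c where "c = Max ((\<lambda>(i, j). \<bar>M $$ (i, j)\<bar>) ` ({..<n} \<times> {..<n}))"
  have c: "\<bar>M $$ (i, j)\<bar> \<le> c" if "i < n" "j < n" for i j
    unfolding c_def using that by (intro Max_ge) auto
  have "summable (\<lambda>k. (real n * c) ^ k / fact k)"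
    using summable_exp[of "real n * c"] by (simp add: divide_inverse mult.commute)
  then show ?thesis
  proof (rule summable_comparison_test[rotated], intro exI allI impI)
    fix k :: nat
    show "norm ((M ^\<^sub>m k) $$ (i, j) / fact k) \<le> (real n * c) ^ k / fact k"
      using pow_mat_entry_bound[OF M c ij, of k] by (simp add: divide_right_mono)
  qed
qed

end

theory Submission
  imports Defs
begin

text \<open>
  The first \<open>n - p\<close> rows \<open>T\<close> of the inverse of the transformation intertwine the two pairs:
  \<open>T A = A\<^sub>o\<^sub>b T\<close> and \<open>C = C\<^sub>o\<^sub>b T\<close>.  Hence \<open>C f(A) = C\<^sub>o\<^sub>b f(A\<^sub>o\<^sub>b) T\<close> for powers and for
  exponentials, so every observability matrix of \<open>(A, C)\<close> is the corresponding matrix of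
  \<open>(A\<^sub>o\<^sub>b, C\<^sub>o\<^sub>b)\<close> times \<open>T\<close>.  If the sampled outputs of \<open>h\<close> vanish, full column rank gives
  \<open>T h = 0\<close>, and then \<open>C A\<^sup>i h = 0\<close> for all \<open>i\<close>.
\<close>

text \<open>The rank is the size of a maximal independent subset of \<open>set (cols A)\<close>, so
  this set has at least \<open>nc\<close> elements; a list of length \<open>nc\<close> with that
  many different entries has no repetition.\<close>

lemma (in vec_space) full_rank_distinct_cols:
  assumes A: "A \<in> carrier_mat n nc" and rank: "rank A = nc"
  shows "distinct (cols A)"
proof -
  let ?P = "\<lambda>T. T \<subseteq> set (cols A) \<and> lin_indpt T"
  have "lin_indpt {}" by (rule finite_lin_indpt2) auto
  then obtain S where S: "maximal S ?P"
    using maximal_exists_superset[OF List.finite_set, of ?P "cols A" "{}"] by blast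
  then have "S \<subseteq> set (cols A)" by (simp add: maximal_def)
  then have "nc \<le> card (set (cols A))"
    using rank_card_indpt[OF A S] rank by (metis List.finite_set card_mono)
  then show ?thesis
    using A by (metis card_distinct card_length carrier_matD(2) cols_length le_antisym)
qed

text \<open>A nonzero kernel vector would be a linear dependence between the columns. Independence
  concerns the set of columns, which does not see a repeated column, so distinctness has to be
  supplied separately.\<close>

lemma (in vec_space) full_rank_mult_vec_eq_0:
  assumes A: "A \<in> carrier_mat n nc" and rank: "rank A = nc"
    and v: "v \<in> carrier_vec nc" and Av: "A *\<^sub>v v = 0\<^sub>v n"
  shows "v = 0\<^sub>v nc"
  using lin_depI[OF A v _ Av] full_rank_distinct_cols[OF A rank] full_rank_lin_indpt[OF A rank]
  by blast

lemma mat_of_rows_mult_vec_eq_0_iff: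
  assumes "set vs \<subseteq> carrier_vec nc"
  shows "mat_of_rows nc vs *\<^sub>v h = 0\<^sub>v (length vs) \<longleftrightarrow> (\<forall>v\<in>set vs. v \<bullet> h = 0)"
proof -
  have "mat_of_rows nc vs *\<^sub>v h = 0\<^sub>v (length vs) \<longleftrightarrow> (\<forall>i<length vs. vs ! i \<bullet> h = 0)"
    using assms by (auto simp: vec_eq_iff subset_iff)
  then show ?thesis by (simp add: all_set_conv_all_nth)
qed

text \<open>Splits a vanishing stacked output into its blocks, so that each instant or power can be
  treated on its own.\<close>

lemma stack_rows_mult_vec_eq_0_iff:
  assumes M: "\<And>x. x \<in> set xs \<Longrightarrow> f x \<in> carrier_mat q nc"
  shows "stack_rows nc (map f xs) *\<^sub>v h = 0\<^sub>v (length xs * q) \<longleftrightarrow>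
    (\<forall>x\<in>set xs. f x *\<^sub>v h = 0\<^sub>v q)"
proof -
  have len: "length (concat (map rows (map f xs))) = length xs * q"
    using M by (induction xs) auto
  have sub: "set (concat (map rows (map f xs))) \<subseteq> carrier_vec nc"
    using M by (fastforce simp: rows_def)
  have row: "(\<forall>v\<in>set (rows (f x)). v \<bullet> h = 0) \<longleftrightarrow> f x *\<^sub>v h = 0\<^sub>v q" if "x \<in> set xs" for x
    using M[OF that] by (auto simp: vec_eq_iff rows_def)
  show ?thesis
    using mat_of_rows_mult_vec_eq_0_iff[OF sub, of h] row
    unfolding len stack_rows_def by simp
qed

text \<open>By induction, \<open>T\<close> moves past one factor \<open>A\<close> at a time and
  turns it into \<open>B\<close>.\<close>

lemma pow_mat_intertwine:
  fixes A B T :: "'a :: comm_ring_1 mat"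
  assumes A: "A \<in> carrier_mat n n" and B: "B \<in> carrier_mat m m" and T: "T \<in> carrier_mat m n"
    and TA: "T * A = B * T"
  shows "T * (A ^\<^sub>m k) = B ^\<^sub>m k * T"
proof (induction k)
  case 0
  then show ?case using assms by simp
next
  case (Suc k)
  have Ak: "A ^\<^sub>m k \<in> carrier_mat n n" and Bk: "B ^\<^sub>m k \<in> carrier_mat m m"
    using A B by auto
  have "T * (A ^\<^sub>m Suc k) = (T * A ^\<^sub>m k) * A"
    using assoc_mult_mat[OF T Ak A] by simp
  also have "\<dots> = B ^\<^sub>m k * (T * A)"
    unfolding Suc.IH by (rule assoc_mult_mat[OF Bk T A])
  also have "\<dots> = B ^\<^sub>m Suc k * T"
    using assoc_mult_mat[OF Bk B T] by (simp add: TA)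
  finally show ?case .
qed

lemma mat_exp_carrier:
  "M \<in> carrier_mat n n \<Longrightarrow> mat_exp M \<in> carrier_mat n n"
  by (intro carrier_matI) (auto simp: mat_exp_def)

lemma index_mult_mat_sum:
  assumes "M \<in> carrier_mat a b" "N \<in> carrier_mat b c" "i < a" "j < c"
  shows "(M * N) $$ (i, j) = (\<Sum>l<b. M $$ (i, l) * N $$ (l, j))"
  using assms by (simp add: scalar_prod_def lessThan_atLeast0)

text \<open>The identity for powers is applied to each term of the exponential series. What remains
  is to exchange the finite sums of the matrix products with the convergent entrywise
  series.\<close>

lemma mat_exp_intertwine:
  fixes A B T :: "real mat"
  assumes A: "A \<in> carrier_mat n n" and B: "B \<in> carrier_mat m m" and T: "T \<in> carrier_mat m n"
    and TA: "T * A = B * T"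
  shows "T * mat_exp A = mat_exp B * T"
proof (rule eq_matI)
  fix i j assume "i < dim_row (mat_exp B * T)" "j < dim_col (mat_exp B * T)"
  then have i: "i < m" and j: "j < n" using B T by (auto simp: mat_exp_def)
  have Ak: "A ^\<^sub>m k \<in> carrier_mat n n" and Bk: "B ^\<^sub>m k \<in> carrier_mat m m" for k
    using A B by auto
  have "(T * mat_exp A) $$ (i, j)
      = (\<Sum>l<n. T $$ (i, l) * (\<Sum>k. (A ^\<^sub>m k) $$ (l, j) / fact k))"
    using A T i j by (simp add: scalar_prod_def mat_exp_def lessThan_atLeast0)
  also have "\<dots> = (\<Sum>l<n. \<Sum>k. T $$ (i, l) * ((A ^\<^sub>m k) $$ (l, j) / fact k))"
    using summable_mat_exp[OF A _ j] by (intro sum.cong refl suminf_mult[symmetric]) auto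
  \<comment> \<open>A finite sum of series may be summed termwise because every entry series
    converges, by \<open>summable_mat_exp\<close>.\<close>
  also have "\<dots> = (\<Sum>k. \<Sum>l<n. T $$ (i, l) * ((A ^\<^sub>m k) $$ (l, j) / fact k))"
    using summable_mat_exp[OF A _ j] by (intro suminf_sum[symmetric] summable_mult) auto
  also have "\<dots> = (\<Sum>k. (T * (A ^\<^sub>m k)) $$ (i, j) / fact k)"
    by (simp add: index_mult_mat_sum[OF T Ak i j] sum_divide_distrib)
  also have "\<dots> = (\<Sum>k. (B ^\<^sub>m k * T) $$ (i, j) / fact k)"
    by (simp only: pow_mat_intertwine[OF A B T TA])
  also have "\<dots> = (\<Sum>k. \<Sum>l<m. (B ^\<^sub>m k) $$ (i, l) / fact k * T $$ (l, j))"
    by (simp add: index_mult_mat_sum[OF Bk T i j] sum_divide_distrib)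
  also have "\<dots> = (\<Sum>l<m. \<Sum>k. (B ^\<^sub>m k) $$ (i, l) / fact k * T $$ (l, j))"
    using summable_mat_exp[OF B i] by (intro suminf_sum summable_mult2) auto
  also have "\<dots> = (\<Sum>l<m. (\<Sum>k. (B ^\<^sub>m k) $$ (i, l) / fact k) * T $$ (l, j))"
    using summable_mat_exp[OF B i] by (intro sum.cong refl suminf_mult2[symmetric]) auto
  also have "\<dots> = (mat_exp B * T) $$ (i, j)"
    using B T i j by (simp add: scalar_prod_def mat_exp_def lessThan_atLeast0)
  finally show "(T * mat_exp A) $$ (i, j) = (mat_exp B * T) $$ (i, j)" .
qed (use A B T in \<open>auto simp: mat_exp_def\<close>)

text \<open>With \<open>E\<close> the block row (1 0), the zero upper right block gives
  \<open>E * (Q * A * P) = A1 * E\<close>, and likewise \<open>C * P = C1 * E\<close>. Cancelling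
  \<open>P\<close> by means of \<open>P * Q = 1\<^sub>m n\<close> shows that
  \<open>T = E * Q\<close> works.\<close>

lemma block_triangular_intertwine:
  fixes A C A1 C1 P Q A21 A2 :: "'a :: comm_ring_1 mat"
  assumes A: "A \<in> carrier_mat n n" and C: "C \<in> carrier_mat q n"
    and P: "P \<in> carrier_mat n n" and Q: "Q \<in> carrier_mat n n" and PQ: "P * Q = 1\<^sub>m n"
    and A1: "A1 \<in> carrier_mat m m" and C1: "C1 \<in> carrier_mat q m"
    and A21: "A21 \<in> carrier_mat p m" and A2: "A2 \<in> carrier_mat p p"
    and QAP: "Q * A * P = four_block_mat A1 (0\<^sub>m m p) A21 A2"
    and CP: "C * P = four_block_mat C1 (0\<^sub>m q p) (0\<^sub>m 0 m) (0\<^sub>m 0 p)"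
  obtains T where "T \<in> carrier_mat m n" "T * A = A1 * T" "C = C1 * T"
proof
  \<comment> \<open>Comparing row counts settles the dimensions; this matters because
    \<open>m\<close> will be the truncated difference \<open>n - p\<close>.\<close>
  have n: "n = m + p"
    using arg_cong[OF QAP, of dim_row] Q A1 A2 by simp
  define E :: "'a mat" where "E = four_block_mat (1\<^sub>m m) (0\<^sub>m m p) (0\<^sub>m 0 m) (0\<^sub>m 0 p)"
  have E: "E \<in> carrier_mat m n" unfolding E_def n by (rule carrier_matI) auto
  \<comment> \<open>Empty blocks turn \<open>X\<close> into a two-by-two block matrix, the form
    required by \<open>mult_four_block_mat\<close>.\<close>
  have pad: "X = four_block_mat X (0\<^sub>m r 0) (0\<^sub>m 0 m) (0\<^sub>m 0 0)"
    if "X \<in> carrier_mat r m" for X :: "'a mat" and r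
    using that by (intro eq_matI) auto
  have XE: "X * E = four_block_mat X (0\<^sub>m r p) (0\<^sub>m 0 m) (0\<^sub>m 0 p)"
    if X: "X \<in> carrier_mat r m" for X :: "'a mat" and r
  proof -
    have "X * E = four_block_mat X (0\<^sub>m r 0) (0\<^sub>m 0 m) (0\<^sub>m 0 0) * E"
      using pad[OF X] by simp
    also have "\<dots> = four_block_mat X (0\<^sub>m r p) (0\<^sub>m 0 m) (0\<^sub>m 0 p)"
      unfolding E_def using X
      by (subst mult_four_block_mat[where ?nr1.0 = r and ?n1.0 = m and ?n2.0 = 0 and ?nr2.0 = 0
            and ?nc1.0 = m and ?nc2.0 = p]) auto
    finally show ?thesis .
  qed
  \<comment> \<open>Multiplying by \<open>E\<close> from the left selects the upper block row
    (\<open>A1\<close> 0), which is \<open>A1 * E\<close>.\<close>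
  have EB: "E * (Q * A * P) = A1 * E"
    unfolding XE[OF A1] QAP unfolding E_def using A1 A21 A2
    by (subst mult_four_block_mat[where ?nr1.0 = m and ?n1.0 = m and ?n2.0 = p and ?nr2.0 = 0
          and ?nc1.0 = m and ?nc2.0 = p]) auto
  have CE: "C * P = C1 * E" unfolding XE[OF C1] CP ..
  show "E * Q \<in> carrier_mat m n" using E Q by simp
  have QA: "Q * A \<in> carrier_mat n n" and QAP': "Q * A * P \<in> carrier_mat n n"
    using Q A P by auto
  have "E * Q * A = E * (Q * A)" by (rule assoc_mult_mat[OF E Q A])
  \<comment> \<open>The factor \<open>P * Q\<close> is inserted so that the block form of
    \<open>Q * A * P\<close> appears.\<close>
  also have "Q * A = Q * A * P * Q"
    using assoc_mult_mat[OF QA P Q] right_mult_one_mat[OF QA] by (simp only: PQ)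
  also have "E * \<dots> = E * (Q * A * P) * Q"
    using assoc_mult_mat[OF E QAP' Q] by simp
  also have "\<dots> = A1 * (E * Q)"
    unfolding EB by (rule assoc_mult_mat[OF A1 E Q])
  finally show "E * Q * A = A1 * (E * Q)" .
  have "C = C * P * Q" using assoc_mult_mat[OF C P Q] C by (simp add: PQ)
  also have "\<dots> = C1 * (E * Q)" unfolding CE by (rule assoc_mult_mat[OF C1 E Q])
  finally show "C = C1 * (E * Q)" .
qed

lemma observable_subsystem_intertwine:
  assumes A: "A \<in> carrier_mat n n" and C: "C \<in> carrier_mat q n"
    and sub: "observable_subsystem A C A_ob C_ob"
  obtains T where "T \<in> carrier_mat (n - kernel_dim (obs_mat A C)) n"
    "T * A = A_ob * T" "C = C_ob * T"
proof -
  let ?p = "kernel_dim (obs_mat A C)"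
  let ?m = "n - ?p"
  from sub A C obtain P Q A21 A_unob where
    "A_ob \<in> carrier_mat ?m ?m" "C_ob \<in> carrier_mat q ?m"
    "P \<in> carrier_mat n n" "Q \<in> carrier_mat n n" "P * Q = 1\<^sub>m n"
    "A21 \<in> carrier_mat ?p ?m" "A_unob \<in> carrier_mat ?p ?p"
    "Q * A * P = four_block_mat A_ob (0\<^sub>m ?m ?p) A21 A_unob"
    "C * P = four_block_mat C_ob (0\<^sub>m q ?p) (0\<^sub>m 0 ?m) (0\<^sub>m 0 ?p)"
    unfolding observable_subsystem_def Let_def inverts_mat_def by auto
  from block_triangular_intertwine[OF A C this(3,4,5,1,2,6,7,8,9)] that show thesis by blast
qed

text \<open>Abstracting to \<open>F\<close> and \<open>G\<close> covers exponentials and powers at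
  once. Each block satisfies \<open>C * F t = C_ob * G t * T\<close>, so
  \<open>T *\<^sub>v h\<close> lies in the kernel of the stack for the observable part, which is
  trivial by full column rank.\<close>

lemma intertwined_full_rank_stack:
  fixes C C_ob T :: "real mat" and F G :: "'a \<Rightarrow> real mat"
  assumes T: "T \<in> carrier_mat m n" and C_ob: "C_ob \<in> carrier_mat q m" and C: "C = C_ob * T"
    and F: "\<And>t. F t \<in> carrier_mat n n" and G: "\<And>t. G t \<in> carrier_mat m m"
    and FG: "\<And>t. T * F t = G t * T"
    and rank: "vec_space.rank (length ts * q) (stack_rows m (map (\<lambda>t. C_ob * G t) ts)) = m"
    and h: "h \<in> carrier_vec n"
    and zero: "stack_rows n (map (\<lambda>t. C * F t) ts) *\<^sub>v h = 0\<^sub>v (length ts * q)"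
  shows "T *\<^sub>v h = 0\<^sub>v m"
proof -
  have Cq: "C \<in> carrier_mat q n" using C C_ob T by simp
  have CF: "C * F t *\<^sub>v h = C_ob * G t *\<^sub>v (T *\<^sub>v h)" for t
  proof -
    have "C * F t = C_ob * G t * T"
      unfolding C using assoc_mult_mat[OF C_ob T F] assoc_mult_mat[OF C_ob G T] by (simp add: FG)
    then show ?thesis
      using assoc_mult_mat_vec[OF mult_carrier_mat[OF C_ob G] T h] by simp
  qed
  have "\<forall>t\<in>set ts. C * F t *\<^sub>v h = 0\<^sub>v q"
    using zero mult_carrier_mat[OF Cq F] by (subst (asm) stack_rows_mult_vec_eq_0_iff) auto
  then have "stack_rows m (map (\<lambda>t. C_ob * G t) ts) *\<^sub>v (T *\<^sub>v h) = 0\<^sub>v (length ts * q)"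
    using C_ob G by (subst stack_rows_mult_vec_eq_0_iff) (auto simp: CF)
  moreover have "stack_rows m (map (\<lambda>t. C_ob * G t) ts) \<in> carrier_mat (length ts * q) m"
    using C_ob by (intro stack_rows_map_carrier) auto
  ultimately show ?thesis
    using vec_space.full_rank_mult_vec_eq_0 rank T h by (metis mult_mat_vec_carrier)
qed

lemma mat_kernel_obs_mat_intertwine:
  assumes A: "A \<in> carrier_mat n n" and C_ob: "C_ob \<in> carrier_mat q m"
    and A_ob: "A_ob \<in> carrier_mat m m" and T: "T \<in> carrier_mat m n"
    and TA: "T * A = A_ob * T" and C: "C = C_ob * T"
    and h: "h \<in> carrier_vec n" and Th: "T *\<^sub>v h = 0\<^sub>v m"
  shows "h \<in> mat_kernel (obs_mat A C)"
proof (rule mat_kernelI[OF _ h])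
  have Cq: "C \<in> carrier_mat q n" using C C_ob T by simp
  show "obs_mat A C \<in> carrier_mat (n * q) n"
    using obs_mat_carrier[of A C] A Cq by simp
  have zero: "X *\<^sub>v 0\<^sub>v m = 0\<^sub>v q" if "X \<in> carrier_mat q m" for X :: "real mat"
    using that by (auto simp: vec_eq_iff)
  have "C * (A ^\<^sub>m i) *\<^sub>v h = 0\<^sub>v q" for i
  proof -
    have Ai: "A ^\<^sub>m i \<in> carrier_mat n n" and Bi: "A_ob ^\<^sub>m i \<in> carrier_mat m m"
      using A A_ob by auto
    have "C * (A ^\<^sub>m i) = C_ob * (A_ob ^\<^sub>m i) * T"
      unfolding C using assoc_mult_mat[OF C_ob T Ai] assoc_mult_mat[OF C_ob Bi T]
      by (simp add: pow_mat_intertwine[OF A A_ob T TA])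
    then have "C * (A ^\<^sub>m i) *\<^sub>v h = C_ob * (A_ob ^\<^sub>m i) *\<^sub>v (T *\<^sub>v h)"
      using assoc_mult_mat_vec[OF mult_carrier_mat[OF C_ob Bi] T h] by simp
    also have "\<dots> = 0\<^sub>v q"
      unfolding Th by (rule zero) (rule mult_carrier_mat[OF C_ob Bi])
    finally show ?thesis .
  qed
  then have "stack_rows n (map (\<lambda>i. C * (A ^\<^sub>m i)) [0..<n]) *\<^sub>v h = 0\<^sub>v (length [0..<n] * q)"
    using A Cq by (subst stack_rows_mult_vec_eq_0_iff) auto
  then show "obs_mat A C *\<^sub>v h = 0\<^sub>v (n * q)"
    using A by (simp add: obs_mat_def)
qed

theorem theorem1:
  fixes A C A_ob C_ob :: "real mat" and n q p :: nat
  assumes "A \<in> carrier_mat n n" and "C \<in> carrier_mat q n"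
    and "p = kernel_dim (obs_mat A C)"
    and "observable_subsystem A C A_ob C_ob"
  shows "(\<forall>ts :: real list. sampling_scheme ts \<longrightarrow>
            vec_space.rank (length ts * q) (sample_obs_mat_ct A_ob C_ob ts) = n - p \<longrightarrow>
            (\<forall>h \<in> carrier_vec n. h \<notin> mat_kernel (obs_mat A C) \<longrightarrow>
               sample_obs_mat_ct A C ts *\<^sub>v h \<noteq> 0\<^sub>v (length ts * q)))
       \<and> (\<forall>ts :: nat list. sampling_scheme ts \<longrightarrow>
            vec_space.rank (length ts * q) (sample_obs_mat_dt A_ob C_ob ts) = n - p \<longrightarrow>
            (\<forall>h \<in> carrier_vec n. h \<notin> mat_kernel (obs_mat A C) \<longrightarrow>
               sample_obs_mat_dt A C ts *\<^sub>v h \<noteq> 0\<^sub>v (length ts * q)))"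
proof -
  note A = assms(1)
  have A_ob: "A_ob \<in> carrier_mat (n - p) (n - p)" and C_ob: "C_ob \<in> carrier_mat q (n - p)"
    using assms unfolding observable_subsystem_def Let_def by auto
  obtain T where T: "T \<in> carrier_mat (n - p) n" and TA: "T * A = A_ob * T" and C: "C = C_ob * T"
    using observable_subsystem_intertwine[OF assms(1,2,4)] assms(3) by metis
  note kernel = mat_kernel_obs_mat_intertwine[OF A C_ob A_ob T TA C]
  note injective = intertwined_full_rank_stack[OF T C_ob C]
  \<comment> \<open>Scaling by \<open>t\<close> preserves the intertwining relation, so the same
    \<open>T\<close> serves every instant.\<close>
  have exp_intertwine: "T * mat_exp (t \<cdot>\<^sub>m A) = mat_exp (t \<cdot>\<^sub>m A_ob) * T" for t
  proof (rule mat_exp_intertwine[OF smult_carrier_mat[OF A] smult_carrier_mat[OF A_ob] T])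
    show "T * (t \<cdot>\<^sub>m A) = t \<cdot>\<^sub>m A_ob * T"
      using mult_smult_distrib[OF T A] mult_smult_assoc_mat[OF A_ob T] TA by simp
  qed
  \<comment> \<open>The contrapositive is shown: an \<open>h\<close> with vanishing sampled output
    is unobservable.\<close>
  have ct: "h \<in> mat_kernel (obs_mat A C)"
    if "vec_space.rank (length ts * q) (sample_obs_mat_ct A_ob C_ob ts) = n - p"
      "h \<in> carrier_vec n" "sample_obs_mat_ct A C ts *\<^sub>v h = 0\<^sub>v (length ts * q)" for ts h
  proof -
    have "T *\<^sub>v h = 0\<^sub>v (n - p)"
      using that A A_ob unfolding sample_obs_mat_ct_def
      by (intro injective[OF _ _ exp_intertwine, where ts = ts]) (auto intro: mat_exp_carrier)
    with that(2) show ?thesis by (rule kernel)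
  qed
  have dt: "h \<in> mat_kernel (obs_mat A C)"
    if "vec_space.rank (length ts * q) (sample_obs_mat_dt A_ob C_ob ts) = n - p"
      "h \<in> carrier_vec n" "sample_obs_mat_dt A C ts *\<^sub>v h = 0\<^sub>v (length ts * q)" for ts h
  proof -
    \<comment> \<open>Unification with the intertwining rule takes \<open>F\<close> and
      \<open>G\<close> to be the powers of \<open>A\<close> and \<open>A_ob\<close>; in continuous
      time they were the exponentials.\<close>
    have "T *\<^sub>v h = 0\<^sub>v (n - p)"
      using that A A_ob unfolding sample_obs_mat_dt_def
      by (intro injective[OF _ _ pow_mat_intertwine[OF A A_ob T TA], where ts = ts]) auto
    with that(2) show ?thesis by (rule kernel)
  qed
  from ct dt show ?thesis by blast
qed

end
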